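(* Let $0<\lambda<2$. For all $x,x'$ with $0\le x<x'\le\infty$, one has $\omega_\lambda(x)\neq\omega_\lambda(x')$.
   Context: Fix a real number $0<\lambda<2$. Let $h(y)=\frac{1}{\lambda-y}$ and $h_0(y)=\frac{y}{\lambda y+1}$. Define $m_0^\lambda=0$ and, as long as $m_i^\lambda<\lambda$, $m_{i+1}^\lambda=h(m_i^\lambda)$ (so $m_1^\lambda=1/\lambda$). This sequence is increasing and finite: there is an integer $i_\lambda\ge 1$ with $0=m_0^\lambda<m_1^\lambda<\cdots<m_{i_\lambda-1}^\lambda<\lambda\le m_{i_\lambda}^\lambda<\infty$. For $0\le i<i_\lambda$ set $h_{i+1}=h\circ h_i$. Let $I_i^\lambda=[m_i^\lambda,m_{i+1}^\lambda)$ for $0\le i<i_\lambda$ and $I_{i_\lambda}^\lambda=[m_{i_\lambda}^\lambda,\infty)$; these intervals partition $[0,\infty)$. For $i<i_\lambda$, $h_i$ is an increasing bijection from $[0,\infty)$ onto $I_i^\lambda$; $h_{i_\lambda}$ is an increasing bijection from $[0,\ell_\lambda)$ onto $I_{i_\lambda}^\lambda$, where $\ell_\lambda=h_{i_\lambda-1}^{-1}(\lambda)$ if $m_{i_\lambda}^\lambda>\lambda$ and $\ell_\lambda=\infty$ if $m_{i_\lambda}^\lambda=\lambda$. The map $T_\lambda:[0,\infty)\to[0,\infty)$ is defined by $T_\lambda(x)=h_i^{-1}(x)$ for $x\in I_i^\lambda$. Coding: for $x\in[0,\infty)$, $\omega_\lambda(x)=x_0x_1x_2\ldots\in\{0,\ldots,i_\lambda\}^{\mathbb{Z}_+}$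 (where $\mathbb{Z}_+=\{0,1,2,\dots\}$), with $x_n$ the unique index such that $T_\lambda^n(x)\in I_{x_n}^\lambda$. The map $x\mapsto\omega_\lambda(x)$ is non-decreasing for the lexicographic order, and $\omega_\lambda(\infty)=\infty_0\infty_1\infty_2\ldots$ denotes its limit as $x\to\infty$: for each $n$, the word $\infty_0\ldots\infty_n$ is the prefix of length $n+1$ of $\omega_\lambda(x)$ for all sufficiently large real $x$. *)

theory Defs
  imports Complex_Main "HOL-Library.Extended_Real"
begin

text \<open>
  Throughout, the parameter \<open>l\<close> is the real number \<open>\<lambda>\<close>, meant to satisfy \<open>0 < l < 2\<close>.
\<close>

definition h :: "real \<Rightarrow> real \<Rightarrow> real" where
  "h l y = 1 / (l - y)"

definition h0 :: "real \<Rightarrow> real \<Rightarrow> real" where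
  "h0 l y = y / (l * y + 1)"

text \<open>
  The sequence is only meaningful up to the first index at which it reaches \<open>l\<close> (the index
  \<open>last_idx l\<close> below); the values the total recursion gives beyond that index are never used.
\<close>

primrec mseq :: "real \<Rightarrow> nat \<Rightarrow> real" where
  "mseq l 0 = 0"
| "mseq l (Suc i) = h l (mseq l i)"

definition last_idx :: "real \<Rightarrow> nat" where
  "last_idx l = (LEAST i. l \<le> mseq l i)"

primrec branch :: "real \<Rightarrow> nat \<Rightarrow> real \<Rightarrow> real" where
  "branch l 0 = h0 l"
| "branch l (Suc i) = h l \<circ> branch l i"

definition Ivl :: "real \<Rightarrow> nat \<Rightarrow> real set" where
  "Ivl l i = (if i < last_idx l then {mseq l i..<mseq l (Suc i)} else {mseq l i..})"

text \<open>
  The domain of the inverse branch \<open>branch l i\<close>: it is \<open>[0,\<infinity>)\<close> for \<open>i < last_idx l\<close> and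
  \<open>[0,\<ell>)\<close> for \<open>i = last_idx l\<close>, where the endpoint \<open>\<ell>\<close> is the preimage of \<open>l\<close> under the
  preceding branch if \<open>mseq l i > l\<close>, and is infinite if \<open>mseq l i = l\<close>.
\<close>

definition branch_dom :: "real \<Rightarrow> nat \<Rightarrow> real set" where
  "branch_dom l i =
     (if i = last_idx l \<and> mseq l i > l
      then {0..<inv_into {0..} (branch l (last_idx l - 1)) l}
      else {0..})"

definition digit :: "real \<Rightarrow> real \<Rightarrow> nat" where
  "digit l x = (THE i. i \<le> last_idx l \<and> x \<in> Ivl l i)"

definition T :: "real \<Rightarrow> real \<Rightarrow> real" where
  "T l x = inv_into (branch_dom l (digit l x)) (branch l (digit l x)) x"

definition coding_real :: "real \<Rightarrow> real \<Rightarrow> nat \<Rightarrow> nat" where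
  "coding_real l x n = digit l ((T l ^^ n) x)"

definition coding_infty :: "real \<Rightarrow> nat \<Rightarrow> nat" where
  "coding_infty l =
     (THE w. \<forall>n. \<forall>\<^sub>F x in at_top. \<forall>k\<le>n. coding_real l x k = w k)"

definition coding :: "real \<Rightarrow> ereal \<Rightarrow> nat \<Rightarrow> nat" where
  "coding l x = (if x = \<infinity> then coding_infty l else coding_real l (real_of_ereal x))"

end

theory Submission
  imports Defs
begin

text \<open>
  Each inverse branch is a Moebius map \<open>y \<mapsto> (u\<^sub>i\<^sub>+\<^sub>1 y + u\<^sub>i) / (u\<^sub>i\<^sub>+\<^sub>2 y + u\<^sub>i\<^sub>+\<^sub>1)\<close> of determinant 1,
  where \<open>u\<close> is the Chebyshev sequence \<open>u\<^sub>0 = 0\<close>, \<open>u\<^sub>1 = 1\<close>, \<open>u\<^sub>n\<^sub>+\<^sub>2 = \<lambda> u\<^sub>n\<^sub>+\<^sub>1 - u\<^sub>n\<close>. Composing the branches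
  along a digit sequence gives matrices with rows \<open>(A, B)\<close> and \<open>(C, D)\<close>. Once \<open>C\<close> and \<open>D\<close> are positive,
  the points whose coding starts with the given word lie between \<open>B / D\<close> and \<open>A / C\<close>, whose
  difference is \<open>1 / (C D)\<close> (lemma \<open>cylinder_length\<close>). Two points with the same coding therefore coincide if
  \<open>C D\<close> is unbounded along that coding.

  The obstacle is the last branch: with \<open>L = i\<^sub>\<lambda>\<close> its index, its matrix has the lower left
  entry \<open>u\<^sub>L\<^sub>+\<^sub>2 \<le> 0\<close>, and if this is not 0 then the branch is elliptic, so it maps no proper
  projective interval into itself. The digit sequence is therefore cut into
  blocks; a block ends as soon as its own lower left entry is positive. (Before that the block agrees
  with the beginning of the coding of \<open>\<infinity>\<close>.) Inside an unfinished block \<open>D\<close> stays in \<open>(0, 1]\<close>: it does not increase under the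
  digit \<open>L\<close> because \<open>u\<^sub>L\<^sub>+\<^sub>1 \<le> 1\<close>, nor under the other digits because \<open>u\<^sub>i\<^sub>+\<^sub>1 \<ge> 1\<close>. This has two effects. The
  lower bound \<open>B / D\<close> grows by at least 1 at each nonzero digit, so that an infinite block would force
  its starting point to be infinite (lemma \<open>block_ends\<close>). When the block does end, \<open>D \<le> 1 + m\<^sub>i C\<close>
  and \<open>B \<ge> m\<^sub>i D\<close>, where \<open>i\<close> is its final digit; with \<open>A D = 1 + B C\<close> this yields \<open>A \<ge> 1\<close> (lemma \<open>positive_block\<close>). So
  appending a block to a word never decreases \<open>C\<close>, and it increases \<open>C D\<close> by at least
  \<open>C\<^sup>2 A' B' \<ge> C\<^sup>2 / \<lambda>\<close>, with \<open>A'\<close> and \<open>B'\<close> the entries of the block, unless the block begins with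
  the digit 0 (lemma \<open>product_grows\<close>). Nonzero digits recur in the coding of every positive point,
  since a step of the map with digit 0 turns \<open>1 / x\<close> into \<open>1 / x - \<lambda>\<close>. Hence \<open>C D\<close> is unbounded.

  The case \<open>x' = \<infinity>\<close> reduces to real points by monotonicity: if \<open>x\<close> had the coding of \<open>\<infinity>\<close>, so would
  \<open>x + 1\<close>.
\<close>

section \<open>The matrices of the inverse branches\<close>

text \<open>
  The Chebyshev polynomials of the second kind at \<open>l / 2\<close>, with the index shifted by one: for
  \<open>l = 2 cos t\<close> the value is \<open>sin (n t) / sin t\<close>.
\<close>

fun cheb :: "real \<Rightarrow> nat \<Rightarrow> real" where
  "cheb l 0 = 0"
| "cheb l (Suc 0) = 1"
| "cheb l (Suc (Suc n)) = l * cheb l (Suc n) - cheb l n"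

lemma cheb_det: "cheb l (Suc i) * cheb l (Suc i) - cheb l i * cheb l (Suc (Suc i)) = 1"
proof (induction i)
  case 0
  show ?case by simp
next
  case (Suc i)
  then show ?case by (simp add: algebra_simps)
qed

locale hecke_map =
  fixes l :: real
  assumes l_pos: "0 < l" and l_less_2: "l < 2"
begin

abbreviation "u \<equiv> cheb l"
abbreviation "L \<equiv> last_idx l"

text \<open>
  Since \<open>l < 2\<close>, the map \<open>h\<close> has no fixed point; \<open>h y - y\<close> has a positive lower bound on \<open>[0, l)\<close>, so
  the sequence cannot remain below \<open>l\<close>.
\<close>

lemma mseq_reaches: "\<exists>i. l \<le> mseq l i"
proof (rule ccontr)
  assume "\<not> ?thesis"
  then have lt: "mseq l i < l" for i by (simp add: not_le)
  define d where "d = (1 - l\<^sup>2/4) / l"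
  have "l\<^sup>2 < 2\<^sup>2" using l_pos l_less_2 by (intro power_strict_mono) auto
  then have d: "d > 0" unfolding d_def using l_pos by simp
  have ge: "real i * d \<le> mseq l i" for i
  proof (induction i)
    case 0
    show ?case by simp
  next
    case (Suc i)
    let ?y = "mseq l i"
    have y: "0 \<le> ?y" "?y < l" using Suc.IH d lt by (auto intro: order_trans[rotated])
    have d0: "0 \<le> d * ?y" using d y by simp
    \<comment> \<open>The inequality \<open>?y + d \<le> 1 / (l - ?y)\<close>, cleared of its denominator, follows by completing
      the square.\<close>
    have "(?y + d) * (l - ?y) = ?y * (l - ?y) + d * l - d * ?y" by algebra
    also have "d * l = 1 - l\<^sup>2/4" unfolding d_def using l_pos by simp
    also have "?y * (l - ?y) + (1 - l\<^sup>2/4) - d * ?y = 1 - (?y - l/2)\<^sup>2 - d * ?y"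
      by (simp add: power2_eq_square field_simps)
    also have "\<dots> \<le> 1" using d0 zero_le_power2[of "?y - l/2"] by linarith
    finally have "?y + d \<le> h l ?y" unfolding h_def using y by (simp add: pos_le_divide_eq)
    then show ?case using Suc.IH by (simp add: algebra_simps)
  qed
  obtain n where "l < real n * d" using d reals_Archimedean3 by blast
  with ge[of n] lt[of n] show False by linarith
qed

lemma mseq_last: "l \<le> mseq l L"
  unfolding last_idx_def using mseq_reaches by (rule LeastI_ex)

lemma mseq_less: "i < L \<Longrightarrow> mseq l i < l"
  unfolding last_idx_def using not_less_Least not_le by blast

lemma last_pos: "0 < L"
proof (rule ccontr)
  assume "\<not> ?thesis"
  then have "L = 0" by simp
  then show False using mseq_last l_pos by simp
qed

lemma cheb_mseq: "i \<le> L \<Longrightarrow> 0 < u (Suc i) \<and> mseq l i = u i / u (Suc i)"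
proof (induction i)
  case 0
  show ?case by simp
next
  case (Suc i)
  then have IH: "0 < u (Suc i)" "mseq l i = u i / u (Suc i)" by auto
  have lt: "0 < l - mseq l i" using mseq_less Suc.prems by simp
  have eq: "u (Suc (Suc i)) = u (Suc i) * (l - mseq l i)" using IH by (simp add: field_simps)
  show ?case
  proof
    show "0 < u (Suc (Suc i))" unfolding eq using IH lt by simp
    show "mseq l (Suc i) = u (Suc i) / u (Suc (Suc i))"
      unfolding eq using IH lt by (simp add: h_def)
  qed
qed

lemma cheb_pos: "i \<le> L \<Longrightarrow> 0 < u (Suc i)"
  using cheb_mseq by blast

lemma mseq_eq: "i \<le> L \<Longrightarrow> mseq l i = u i / u (Suc i)"
  using cheb_mseq by blast

lemma cheb_nonneg: "i \<le> Suc L \<Longrightarrow> 0 \<le> u i"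
  using cheb_pos[of "i - 1"] by (cases i) auto

lemma cheb_last: "u (Suc (Suc L)) \<le> 0"
proof -
  have "u (Suc (Suc L)) = u (Suc L) * (l - mseq l L)"
    using cheb_pos[of L] mseq_eq[of L] by (simp add: field_simps)
  then show ?thesis using cheb_pos[of L] mseq_last by (simp add: mult_le_0_iff)
qed

text \<open>
  The determinant identity reads \<open>u\<^sub>i\<^sub>+\<^sub>1\<^sup>2 = 1 + u\<^sub>i u\<^sub>i\<^sub>+\<^sub>2\<close>, and \<open>u\<^sub>i\<^sub>+\<^sub>2\<close> is positive for \<open>i < L\<close> but
  not for \<open>i = L\<close>. This change of sign puts \<open>u\<^sub>i\<^sub>+\<^sub>1\<close> on different sides of 1 in the two cases.
\<close>

lemma cheb_ge_1:
  assumes "i < L" shows "1 \<le> u (Suc i)"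
proof -
  have "0 \<le> u i * u (Suc (Suc i))" using assms by (intro mult_nonneg_nonneg cheb_nonneg) auto
  then have "1\<^sup>2 \<le> (u (Suc i))\<^sup>2" using cheb_det[of l i] by (simp add: power2_eq_square)
  then show ?thesis using cheb_pos[of i] assms power2_le_imp_le[of 1 "u (Suc i)"] by simp
qed

lemma cheb_last_le_1: "u (Suc L) \<le> 1"
proof -
  have "u L * u (Suc (Suc L)) \<le> 0"
    using cheb_nonneg[of L] cheb_last by (simp add: mult_nonneg_nonpos)
  then have "(u (Suc L))\<^sup>2 \<le> 1\<^sup>2" using cheb_det[of l L] by (simp add: power2_eq_square)
  then show ?thesis by (rule power2_le_imp_le) simp
qed

lemma mseq_step: "i < L \<Longrightarrow> mseq l i < mseq l (Suc i)"
  using cheb_det[of l i] cheb_pos[of i] cheb_pos[of "Suc i"]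
  by (simp add: mseq_eq del: mseq.simps cheb.simps) (simp add: field_simps del: cheb.simps)

lemma mseq_mono: "j \<le> L \<Longrightarrow> i \<le> j \<Longrightarrow> mseq l i \<le> mseq l j"
proof (induction j)
  case 0
  then show ?case by simp
next
  case (Suc j)
  then show ?case using mseq_step[of j] by (cases "i = Suc j") (auto simp del: mseq.simps)
qed

lemma branch_eq:
  assumes "i \<le> L" "0 \<le> y"
  shows "branch l i y = (u (Suc i) * y + u i) / (u (Suc (Suc i)) * y + u (Suc i))"
  using assms(1)
proof (induction i)
  case 0
  show ?case by (simp add: h0_def)
next
  case (Suc i)
  define n where "n = u (Suc i) * y + u i"
  define d where "d = u (Suc (Suc i)) * y + u (Suc i)"
  have "0 < d" unfolding d_def
    using Suc.prems cheb_pos[of i] cheb_nonneg[of "Suc (Suc i)"] assms(2)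
    by (intro add_nonneg_pos mult_nonneg_nonneg) auto
  moreover have "branch l i y = n / d" using Suc by (simp add: n_def d_def del: cheb.simps)
  ultimately have "branch l (Suc i) y = d / (l * d - n)"
    by (simp add: h_def diff_divide_eq_iff)
  also have "l * d - n = u (Suc (Suc (Suc i))) * y + u (Suc (Suc i))"
    unfolding n_def d_def by (simp add: algebra_simps)
  finally show ?case unfolding d_def .
qed

section \<open>One step of the map\<close>

lemma Ivl_mono:
  assumes "i \<le> L" "x \<in> Ivl l i" "j \<le> L" "y \<in> Ivl l j" "x \<le> y"
  shows "i \<le> j"
proof (rule ccontr)
  assume "\<not> i \<le> j"
  then have "mseq l (Suc j) \<le> mseq l i" using assms by (intro mseq_mono) auto
  then show False using assms \<open>\<not> i \<le> j\<close> unfolding Ivl_def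
    by (auto simp del: mseq.simps split: if_splits)
qed

lemma Ivl_exists:
  assumes "0 \<le> x" shows "\<exists>i\<le>L. x \<in> Ivl l i"
proof -
  define i where "i = (GREATEST i. i \<le> L \<and> mseq l i \<le> x)"
  have P: "i \<le> L \<and> mseq l i \<le> x" unfolding i_def
    by (rule GreatestI_nat[where k = 0 and b = L]) (use assms in auto)
  have "x < mseq l (Suc i)" if "i < L"
  proof (rule ccontr)
    assume "\<not> ?thesis"
    then have "Suc i \<le> L \<and> mseq l (Suc i) \<le> x" using that by auto
    from Greatest_le_nat[where P = "\<lambda>i. i \<le> L \<and> mseq l i \<le> x" and b = L, OF this]
    have "Suc i \<le> i" unfolding i_def by auto
    then show False by simp
  qed
  then have "x \<in> Ivl l i" using P unfolding Ivl_def by (cases "i < L") (simp_all del: mseq.simps, auto)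
  then show ?thesis using P by blast
qed

lemma digit_Ivl:
  assumes "0 \<le> x" shows "digit l x \<le> L \<and> x \<in> Ivl l (digit l x)"
proof -
  have "\<exists>!i. i \<le> L \<and> x \<in> Ivl l i"
    using Ivl_exists[OF assms] Ivl_mono by (metis order_refl order_antisym)
  then show ?thesis unfolding digit_def by (rule theI')
qed

lemma digit_mono: "0 \<le> x \<Longrightarrow> x \<le> y \<Longrightarrow> digit l x \<le> digit l y"
  using digit_Ivl[of x] digit_Ivl[of y] Ivl_mono[of _ x _ y] by force

text \<open>
  The right end of the domain of the last branch is the pole of its Moebius map, so that on
  \<open>[0, \<infinity>)\<close> membership in the domain means that the denominator is positive.
\<close>

lemma branch_dom_last_end:
  assumes "l < mseq l L"
  defines "e \<equiv> inv_into {0..} (branch l (L - 1)) l"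
  shows "0 \<le> e" "u (Suc (Suc L)) * e + u (Suc L) = 0" "u (Suc (Suc L)) < 0"
proof -
  obtain j where j: "L = Suc j" using last_pos by (cases L) auto
  note pos = cheb_pos[of L] cheb_pos[of j]
  have "mseq l L = u L / u (Suc L)" by (simp add: mseq_eq)
  then have "l * u (Suc L) < u L" using assms(1) pos by (simp add: pos_less_divide_eq)
  then show neg: "u (Suc (Suc L)) < 0" by simp
  define z where "z = - u (Suc L) / u (Suc (Suc L))"
  have z: "0 \<le> z" "u (Suc (Suc L)) * z + u (Suc L) = 0"
    unfolding z_def using neg pos by (auto simp: divide_le_0_iff simp del: cheb.simps)
  have den: "0 < u (Suc L) * w + u L" if "0 \<le> w" for w
    using pos that j by (intro add_nonneg_pos mult_nonneg_nonneg) auto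
  have br: "branch l j w = l \<longleftrightarrow> u (Suc (Suc L)) * w + u (Suc L) = 0" if "0 \<le> w" for w
  proof -
    have "branch l j w = (u L * w + u j) / (u (Suc L) * w + u L)"
      using branch_eq[of j w] that j by (simp del: cheb.simps)
    then have "branch l j w = l \<longleftrightarrow> u L * w + u j = l * (u (Suc L) * w + u L)"
      using den[OF that] by (simp add: divide_eq_eq del: cheb.simps)
    moreover have "u (Suc (Suc L)) * w + u (Suc L) = l * (u (Suc L) * w + u L) - (u L * w + u j)"
      by (simp add: j algebra_simps)
    ultimately show ?thesis by auto
  qed
  have "l \<in> branch l j ` {0..}" using br z by force
  then have "0 \<le> e" "branch l j e = l" unfolding e_def j
    using inv_into_into[of l "branch l j" "{0..}"] f_inv_into_f[of l "branch l j" "{0..}"] by auto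
  then show "0 \<le> e" "u (Suc (Suc L)) * e + u (Suc L) = 0" using br by auto
qed

text \<open>
  The Moebius relation is written without division. The third conjunct, equivalent to
  \<open>mseq l i \<le> x\<close>, controls the sign of the denominators in words where \<open>C \<le> 0\<close>.
\<close>

definition inverse_step :: "nat \<Rightarrow> real \<Rightarrow> real \<Rightarrow> bool" where
  "inverse_step i y x \<longleftrightarrow> i \<le> L \<and> 0 \<le> y \<and> u i \<le> u (Suc i) * x \<and>
     0 < u (Suc (Suc i)) * y + u (Suc i) \<and>
     x * (u (Suc (Suc i)) * y + u (Suc i)) = u (Suc i) * y + u i"

lemma T_inverse_step:
  assumes "0 \<le> x" shows "inverse_step (digit l x) (T l x) x"
proof -
  define i where "i = digit l x"
  have i: "i \<le> L" "x \<in> Ivl l i" using digit_Ivl[OF assms] by (auto simp: i_def)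
  have pos: "0 < u (Suc i)" using i cheb_pos by simp
  have mi: "u i \<le> u (Suc i) * x"
  proof -
    have "mseq l i \<le> x" using i by (auto simp: Ivl_def split: if_splits)
    then show ?thesis using i pos mseq_eq[of i] by (simp add: pos_divide_le_eq mult.commute)
  qed
  have den: "0 < u (Suc i) - u (Suc (Suc i)) * x"
  proof (cases "i < L")
    case True
    then have "x < mseq l (Suc i)" using i by (auto simp: Ivl_def)
    then show ?thesis using True cheb_pos[of "Suc i"] mseq_eq[of "Suc i"]
      by (simp add: field_simps del: mseq.simps cheb.simps)
  next
    case False
    then have "i = L" using i by simp
    then have "u (Suc (Suc i)) * x \<le> 0"
      using cheb_last assms by (simp add: mult_nonpos_nonneg del: cheb.simps)
    then show ?thesis using pos by linarith
  qed
  \<comment> \<open>The candidate preimage is the value of the inverse matrix at \<open>x\<close>.\<close>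
  define z where "z = (u (Suc i) * x - u i) / (u (Suc i) - u (Suc (Suc i)) * x)"
  have z0: "0 \<le> z" unfolding z_def using den mi by simp
  have zeq: "z * (u (Suc i) - u (Suc (Suc i)) * x) = u (Suc i) * x - u i"
    unfolding z_def using den by simp
  have "(u (Suc (Suc i)) * z + u (Suc i)) * (u (Suc i) - u (Suc (Suc i)) * x) = 1"
    using zeq cheb_det[of l i] by algebra
  then have zden: "0 < u (Suc (Suc i)) * z + u (Suc i)"
    using den by (metis zero_less_mult_pos2 zero_less_one)
  have dom: "w \<in> branch_dom l i \<longleftrightarrow> 0 \<le> w \<and> 0 < u (Suc (Suc i)) * w + u (Suc i)" for w
  proof (cases "i = L \<and> l < mseq l i")
    case True
    then have i: "i = L" "l < mseq l L" by auto
    let ?e = "inv_into {0..} (branch l (L - 1)) l"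
    note e = branch_dom_last_end[OF i(2)]
    have "u (Suc (Suc L)) * w + u (Suc L) = u (Suc (Suc L)) * (w - ?e)"
      using e(2) by (simp add: algebra_simps del: cheb.simps)
    then have "0 < u (Suc (Suc L)) * w + u (Suc L) \<longleftrightarrow> w < ?e"
      using e(3) by (simp add: zero_less_mult_iff del: cheb.simps)
    then show ?thesis using i by (auto simp: branch_dom_def simp del: cheb.simps)
  next
    case False
    have "0 \<le> u (Suc (Suc i))"
    proof (cases "i = L")
      case True
      then have "mseq l L = l" using False mseq_last by auto
      then have "u L = l * u (Suc L)" using mseq_eq[of L] cheb_pos[of L] by (simp add: field_simps)
      then show ?thesis using True by simp
    next
      case False
      then show ?thesis using i cheb_nonneg[of "Suc (Suc i)"] by simp
    qed
    then have "0 < u (Suc (Suc i)) * w + u (Suc i)" if "0 \<le> w"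
      using that pos by (intro add_nonneg_pos mult_nonneg_nonneg)
    then show ?thesis using False by (auto simp: branch_dom_def simp del: cheb.simps)
  qed
  have "branch l i z = x"
  proof -
    have "u (Suc i) * z + u i = x * (u (Suc (Suc i)) * z + u (Suc i))"
      using zeq by (simp add: algebra_simps del: cheb.simps)
    then show ?thesis
      using branch_eq[OF i(1) z0] zden by (simp add: nonzero_divide_eq_eq del: cheb.simps)
  qed
  moreover have "z \<in> branch_dom l i" using dom z0 zden by simp
  ultimately have "x \<in> branch l i ` branch_dom l i" by blast
  then have y: "T l x \<in> branch_dom l i" "branch l i (T l x) = x"
    unfolding T_def i_def[symmetric] by (auto intro: inv_into_into f_inv_into_f)
  then have "0 \<le> T l x" "0 < u (Suc (Suc i)) * T l x + u (Suc i)" using dom by auto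
  then show ?thesis unfolding i_def[symmetric] inverse_step_def
    using y i mi branch_eq[of i "T l x"] by (simp add: field_simps del: cheb.simps)
qed

lemma inverse_step_less:
  assumes "inverse_step i y x" "inverse_step i y' x'" "x < x'"
  shows "y < y'"
proof -
  let ?d = "u (Suc (Suc i)) * y + u (Suc i)" and ?d' = "u (Suc (Suc i)) * y' + u (Suc i)"
  have "x * ?d = u (Suc i) * y + u i" "x' * ?d' = u (Suc i) * y' + u i"
    using assms(1,2) by (auto simp: inverse_step_def)
  then have "(x' - x) * (?d * ?d') = y' - y" using cheb_det[of l i] by algebra
  moreover have "0 < (x' - x) * (?d * ?d')"
    using assms by (intro mult_pos_pos) (auto simp: inverse_step_def)
  ultimately show ?thesis by simp
qed

definition orbit :: "(nat \<Rightarrow> nat) \<Rightarrow> (nat \<Rightarrow> real) \<Rightarrow> bool" where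
  "orbit c y \<longleftrightarrow> (\<forall>n. inverse_step (c n) (y (Suc n)) (y n))"

lemma orbit_coding:
  assumes "0 \<le> x" shows "orbit (coding_real l x) (\<lambda>n. (T l ^^ n) x)"
proof -
  have "0 \<le> (T l ^^ n) x" for n
  proof (induction n)
    case (Suc n)
    then show ?case using T_inverse_step by (simp add: inverse_step_def)
  qed (use assms in simp)
  then show ?thesis using T_inverse_step by (simp add: orbit_def coding_real_def)
qed

lemma orbit_shift: "orbit c y \<Longrightarrow> orbit (\<lambda>j. c (s + j)) (\<lambda>j. y (s + j))"
  by (simp add: orbit_def)

lemma orbit_bounds:
  assumes "orbit c y"
  shows orbit_digit_le: "c n \<le> L" and orbit_lower: "u (c n) \<le> u (Suc (c n)) * y n"
  using assms by (auto simp: orbit_def inverse_step_def)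

lemma orbit_nonneg:
  assumes "orbit c y" shows "0 \<le> y n"
proof -
  have "0 \<le> u (Suc (c n)) * y n"
    using orbit_bounds[OF assms, of n] cheb_nonneg[of "c n"] by linarith
  then show ?thesis using cheb_pos[OF orbit_digit_le[OF assms], of n] by (simp add: zero_le_mult_iff)
qed

lemma orbit_less:
  assumes "orbit c y" "orbit c y'" "y 0 < y' 0"
  shows "y n < y' n"
proof (induction n)
  case (Suc n)
  moreover have "inverse_step (c n) (y (Suc n)) (y n)" "inverse_step (c n) (y' (Suc n)) (y' n)"
    using assms(1,2) unfolding orbit_def by blast+
  ultimately show ?case using inverse_step_less by blast
qed (use assms in simp)

text \<open>
  A step with digit 0 decreases \<open>1 / y\<close> by \<open>l\<close>, which a positive point allows only finitely often.
\<close>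

lemma orbit_nonzero_digit:
  assumes "orbit c y" "0 < y 0"
  shows "\<exists>n. c n \<noteq> 0"
proof (rule ccontr)
  assume "\<not> ?thesis"
  then have c: "c n = 0" for n by simp
  have step: "y n * (l * y (Suc n) + 1) = y (Suc n)" "0 \<le> y (Suc n)" for n
  proof -
    have "inverse_step 0 (y (Suc n)) (y n)" using assms(1) c[of n] unfolding orbit_def by metis
    then show "y n * (l * y (Suc n) + 1) = y (Suc n)" "0 \<le> y (Suc n)"
      by (simp_all add: inverse_step_def)
  qed
  have inv: "0 < y n \<and> inverse (y n) = inverse (y 0) - real n * l" for n
  proof (induction n)
    case (Suc n)
    then have "y (Suc n) \<noteq> 0" using step(1)[of n] by auto
    then have p: "0 < y (Suc n)" using step(2)[of n] by simp
    then have "inverse (y (Suc n)) = inverse (y n) - l" using step(1)[of n] Suc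
      by (simp add: field_simps)
    then show ?case using p Suc by (simp add: algebra_simps)
  qed (use assms in simp)
  obtain n where "inverse (y 0) < real n * l" using l_pos reals_Archimedean3 by blast
  moreover have "0 < inverse (y n)" "inverse (y n) = inverse (y 0) - real n * l"
    using inv[of n] positive_imp_inverse_positive by blast+
  ultimately show False by linarith
qed

section \<open>Products of branch matrices\<close>

text \<open>
  Multiplying by branch matrices on the right acts on each row separately. A word is therefore
  described by its effect on a single row \<open>v\<close>; the rows of its matrix are the images of the rows of
  the identity matrix.
\<close>

primrec row :: "(nat \<Rightarrow> nat) \<Rightarrow> real \<times> real \<Rightarrow> nat \<Rightarrow> real \<times> real" where
  "row c v 0 = v"
| "row c v (Suc k) =
     (fst (row c v k) * u (Suc (c k)) + snd (row c v k) * u (Suc (Suc (c k))),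
      fst (row c v k) * u (c k) + snd (row c v k) * u (Suc (c k)))"

abbreviation "A c k \<equiv> fst (row c (1, 0) k)"
abbreviation "B c k \<equiv> snd (row c (1, 0) k)"
abbreviation "C c k \<equiv> fst (row c (0, 1) k)"
abbreviation "D c k \<equiv> snd (row c (0, 1) k)"

lemma row_add: "row c v (s + k) = row (\<lambda>j. c (s + j)) (row c v s) k"
  by (induction k) (simp_all del: cheb.simps)

lemma row_linear:
  "row c v k = (fst v * A c k + snd v * C c k, fst v * B c k + snd v * D c k)"
proof (induction k)
  case 0
  show ?case by simp
next
  case (Suc k)
  show ?case unfolding row.simps(2)[of c v] Suc by (simp add: algebra_simps del: cheb.simps)
qed

lemma row_det: "A c k * D c k - B c k * C c k = 1"
proof (induction k)
  case 0
  show ?case by simp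
next
  case (Suc k)
  have "A c (Suc k) * D c (Suc k) - B c (Suc k) * C c (Suc k)
     = (A c k * D c k - B c k * C c k)
       * (u (Suc (c k)) * u (Suc (c k)) - u (c k) * u (Suc (Suc (c k))))"
    by (simp add: algebra_simps del: cheb.simps)
  then show ?case using Suc cheb_det by simp
qed

lemma row_orbit:
  assumes "orbit c y"
  shows "y 0 * (C c k * y k + D c k) = A c k * y k + B c k" "0 < C c k * y k + D c k"
proof (induction k)
  case 0
  { case 1 show ?case by simp }
  { case 2 show ?case by simp }
next
  case (Suc k)
  define d where "d = u (Suc (Suc (c k))) * y (Suc k) + u (Suc (c k))"
  have d: "0 < d" "y k * d = u (Suc (c k)) * y (Suc k) + u (c k)"
    using assms by (auto simp: orbit_def inverse_step_def d_def)
  have C: "C c (Suc k) * y (Suc k) + D c (Suc k) = (C c k * y k + D c k) * d"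
    using d(2) unfolding row.simps fst_conv snd_conv d_def by algebra
  have A: "A c (Suc k) * y (Suc k) + B c (Suc k) = (A c k * y k + B c k) * d"
    using d(2) unfolding row.simps fst_conv snd_conv d_def by algebra
  { case 1 show ?case unfolding A C using Suc(1) by (metis mult.assoc) }
  { case 2 show ?case unfolding C using Suc(2) d by simp }
qed

text \<open>
  By the determinant identity, \<open>y\<^sub>0 D - B\<close> is \<open>y\<^sub>k\<close> divided by the positive number \<open>C y\<^sub>k + D\<close>.
  The bound serves inside unfinished blocks, where \<open>C \<le> 0\<close>, as well as for finished cylinders.
\<close>

lemma row_lower:
  assumes "orbit c y" "0 < D c k"
  shows "B c k \<le> y 0 * D c k"
proof -
  let ?e = "C c k * y k + D c k"
  note e = row_orbit[OF assms(1), of k]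
  have y: "0 \<le> y k" using assms(1) by (rule orbit_nonneg)
  have "y 0 * D c k * ?e - B c k * ?e = y k"
    using e(1) row_det[of c k] by algebra
  then have "0 \<le> (y 0 * D c k - B c k) * ?e" using y by (simp add: algebra_simps)
  then show ?thesis using e(2) by (simp add: zero_le_mult_iff)
qed

lemma row_upper:
  assumes "orbit c y" "0 < C c k" "0 < D c k"
  shows "y 0 * C c k \<le> A c k"
proof -
  let ?e = "C c k * y k + D c k"
  note e = row_orbit[OF assms(1), of k]
  have "A c k * ?e - y 0 * C c k * ?e = 1"
    using e(1) row_det[of c k] by algebra
  then have "0 \<le> (A c k - y 0 * C c k) * ?e" by (simp add: algebra_simps)
  then show ?thesis using e(2) by (simp add: zero_le_mult_iff)
qed

lemma cylinder_length:
  assumes "orbit c y" "orbit c y'" "0 < C c k" "0 < D c k"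
  shows "(y' 0 - y 0) * (C c k * D c k) \<le> 1"
proof -
  have "y' 0 * C c k * D c k \<le> A c k * D c k"
    using row_upper[OF assms(2-4)] assms(4) by (simp add: mult_right_mono)
  moreover have "B c k * C c k \<le> y 0 * D c k * C c k"
    using row_lower[OF assms(1,4)] assms(3) by (simp add: mult_right_mono)
  ultimately show ?thesis using row_det[of c k] by (simp add: algebra_simps)
qed

section \<open>Blocks\<close>

text \<open>
  For \<open>C \<le> 0\<close> the positive denominator \<open>C y + D\<close> decreases in \<open>y\<close>, so replacing \<open>y\<close> by the left end
  of its interval \<open>Ivl l i\<close> keeps it positive; there it is a positive multiple of the next \<open>D\<close>. So \<open>D\<close>
  is still positive at the end of a block, where \<open>C\<close> has just changed sign.
\<close>

lemma D_Suc_pos: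
  assumes "orbit c y" "C c k \<le> 0" shows "0 < D c (Suc k)"
proof -
  have "C c k * (u (Suc (c k)) * y k) \<le> C c k * u (c k)"
    using orbit_lower[OF assms(1), of k] assms(2) by (rule mult_left_mono_neg)
  moreover have "0 < u (Suc (c k)) * (C c k * y k + D c k)"
    using row_orbit(2)[OF assms(1), of k] cheb_pos[OF orbit_digit_le[OF assms(1), of k]] by simp
  ultimately show ?thesis by (simp add: algebra_simps del: cheb.simps)
qed

lemma D_pos:
  assumes "orbit c y" "\<And>j. j < k \<Longrightarrow> C c j \<le> 0" shows "0 < D c k"
  using D_Suc_pos[OF assms(1)] assms(2) by (cases k) (auto simp del: row.simps(2))

lemma D_C_relation: "u (Suc (c k)) * D c (Suc k) = D c k + u (c k) * C c (Suc k)"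
  unfolding row.simps fst_conv snd_conv using cheb_det[of l "c k"] by algebra

text \<open>
  Inside an unfinished block \<open>D\<close> does not increase. For digits below \<open>L\<close> this is the relation
  \<open>D_C_relation\<close> together with \<open>u\<^sub>i\<^sub>+\<^sub>1 \<ge> 1\<close>; for the digit \<open>L\<close> it is read off the recursion, because
  \<open>u\<^sub>L\<^sub>+\<^sub>1 \<le> 1\<close>.
\<close>

lemma D_le_1:
  assumes "orbit c y" "\<And>j. j \<le> k \<Longrightarrow> C c j \<le> 0" shows "D c k \<le> 1"
  using assms(2)
proof (induction k)
  case 0
  show ?case by simp
next
  case (Suc k)
  have IH: "D c k \<le> 1" "C c k \<le> 0" using Suc by auto
  have pos: "0 < D c k" "0 < D c (Suc k)"
    using D_pos[OF assms(1), of k] D_pos[OF assms(1), of "Suc k"] Suc.prems by auto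
  have ck: "c k \<le> L" using assms(1) by (rule orbit_digit_le)
  have "D c (Suc k) \<le> D c k"
  proof (cases "c k < L")
    case True
    have "1 * D c (Suc k) \<le> u (Suc (c k)) * D c (Suc k)"
      using cheb_ge_1[OF True] pos(2) by (intro mult_right_mono) auto
    also have "\<dots> \<le> D c k"
      using D_C_relation[of c k] Suc.prems[of "Suc k"] cheb_nonneg[of "c k"] ck
      by (simp add: mult_nonneg_nonpos del: row.simps)
    finally show ?thesis by simp
  next
    case False
    then have L: "c k = L" using ck by simp
    have "C c k * u L \<le> 0" using IH(2) cheb_nonneg[of L] by (simp add: mult_nonpos_nonneg)
    moreover have "D c k * u (Suc L) \<le> D c k * 1"
      using cheb_last_le_1 pos by (intro mult_left_mono) auto
    ultimately show ?thesis using L by simp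
  qed
  then show ?case using IH by simp
qed

text \<open>
  The ratio \<open>B / D\<close> is the image of 0, hence the left end of the cylinder. It moves to the right as
  digits are appended.
\<close>

lemma ratio_Suc:
  assumes "0 < D c k" "0 < D c (Suc k)"
  shows "B c (Suc k) / D c (Suc k) = B c k / D c k + u (c k) / (D c k * D c (Suc k))"
proof -
  have "B c (Suc k) * D c k = B c k * D c (Suc k) + u (c k)"
    unfolding row.simps fst_conv snd_conv using row_det[of c k] by algebra
  then show ?thesis using assms by (simp add: field_simps del: row.simps cheb.simps)
qed

lemma ratio_ge_first_digit:
  assumes "orbit c y" "\<And>j. j < Suc k \<Longrightarrow> C c j \<le> 0"
  shows "mseq l (c 0) \<le> B c (Suc k) / D c (Suc k)"
  using assms(2)
proof (induction k)
  case 0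
  show ?case using mseq_eq[OF orbit_digit_le[OF assms(1), of 0]] by simp
next
  case (Suc k)
  have pos: "0 < D c (Suc k)" "0 < D c (Suc (Suc k))"
    using Suc.prems by (auto intro!: D_pos[OF assms(1)] simp del: row.simps)
  have "0 \<le> u (c (Suc k)) / (D c (Suc k) * D c (Suc (Suc k)))"
    using pos cheb_nonneg[of "c (Suc k)"] orbit_digit_le[OF assms(1), of "Suc k"]
    by (intro divide_nonneg_pos) auto
  then show ?case using Suc.IH Suc.prems ratio_Suc[OF pos] by fastforce
qed

text \<open>
  In an infinite block the denominators in \<open>ratio_Suc\<close> stay at most 1, so each nonzero digit moves the
  lower bound \<open>B / D\<close> for \<open>y 0\<close> by at least 1.
\<close>

lemma block_ends:
  assumes "orbit c y" "\<And>s. \<exists>n\<ge>s. c n \<noteq> 0"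
  shows "\<exists>k. 0 < C c k"
proof (rule ccontr)
  assume "\<not> ?thesis"
  then have C: "C c k \<le> 0" for k by (simp add: not_less)
  have D: "0 < D c k" "D c k \<le> 1" for k
    using D_pos[OF assms(1)] D_le_1[OF assms(1)] C by auto
  define q where "q k = B c k / D c k" for k
  have step: "q k + u (c k) \<le> q (Suc k)" for k
  proof -
    have "0 \<le> u (c k)" using cheb_nonneg[of "c k"] orbit_digit_le[OF assms(1), of k] by simp
    moreover have "0 < D c k * D c (Suc k)" "D c k * D c (Suc k) \<le> 1"
      using D by (auto intro: mult_pos_pos mult_le_one less_imp_le simp del: row.simps)
    ultimately have "u (c k) \<le> u (c k) / (D c k * D c (Suc k))"
      by (simp add: pos_le_divide_eq mult_left_le)
    then show ?thesis unfolding q_def using ratio_Suc[OF D(1) D(1)] by simp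
  qed
  have u0: "0 \<le> u (c k)" for k
    using cheb_nonneg[of "c k"] orbit_digit_le[OF assms(1), of k] by simp
  have mono: "mono q"
    by (rule mono_iff_le_Suc[THEN iffD2]) (use step u0 in \<open>smt (verit)\<close>)
  have "\<exists>k. real N \<le> q k" for N
  proof (induction N)
    case 0
    show ?case by (rule exI[of _ 0]) (simp add: q_def)
  next
    case (Suc N)
    then obtain k where k: "real N \<le> q k" by blast
    obtain n where n: "n \<ge> k" "c n \<noteq> 0" using assms(2) by blast
    then obtain i where i: "c n = Suc i" by (cases "c n") auto
    then have "1 \<le> u (c n)" using cheb_ge_1[of i] orbit_digit_le[OF assms(1), of n] by simp
    then have "real (Suc N) \<le> q (Suc n)" using step[of n] k monoD[OF mono n(1)] by simp
    then show ?case by blast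
  qed
  moreover have "q k \<le> y 0" for k
    unfolding q_def using row_lower[OF assms(1) D(1)] D(1) by (simp add: pos_divide_le_eq)
  moreover obtain N where "y 0 < real N" using reals_Archimedean2 by blast
  ultimately show False by (meson not_less order_trans)
qed

text \<open>
  The key estimate. A finished block has a nonnegative matrix, and \<open>A \<ge> 1\<close> prevents the product of
  many blocks from having a lower left entry that tends to 0. Since \<open>A D \<ge> 1\<close>, only the
  case \<open>D > 1\<close> is at issue, and there \<open>D\<close> can exceed 1 only by \<open>m\<^sub>i C\<close>, where \<open>i\<close> is the final digit of
  the block; this is at most \<open>B C = A D - 1\<close>, because \<open>B \<ge> m\<^sub>i D \<ge> m\<^sub>i\<close>.
\<close>

lemma positive_block:
  assumes "orbit c y" "\<And>s. \<exists>n\<ge>s. c n \<noteq> 0"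
  obtains k where "0 < C c k" "0 < D c k" "1 \<le> A c k" "0 \<le> B c k"
    "c 0 \<noteq> 0 \<Longrightarrow> 1 \<le> l * (A c k * B c k)"
proof -
  define k where "k = (LEAST k. 0 < C c k)"
  have Ck: "0 < C c k" unfolding k_def using block_ends[OF assms] by (rule LeastI_ex)
  have Cj: "C c j \<le> 0" if "j < k" for j
    using not_less_Least[of j "\<lambda>k. 0 < C c k"] that unfolding k_def by simp
  obtain j where j: "k = Suc j" using Ck by (cases k) auto
  have Dk: "0 < D c k" and Dj: "0 < D c j" using D_pos[OF assms(1), of k] D_pos[OF assms(1), of j] Cj j by (blast, simp)
  have Dj1: "D c j \<le> 1" using D_le_1[OF assms(1)] Cj j by auto
  define i where "i = c j"
  have iL: "i \<le> L" unfolding i_def using assms(1) by (rule orbit_digit_le)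
  have "i \<noteq> L"
  proof
    assume "i = L"
    then have "C c k = C c j * u (Suc L) + D c j * u (Suc (Suc L))"
      by (simp add: j i_def del: cheb.simps)
    also have "\<dots> \<le> 0"
      using Cj[of j] j Dj cheb_last cheb_pos[of L]
      by (intro add_nonpos_nonpos mult_nonpos_nonneg mult_nonneg_nonpos) auto
    finally show False using Ck by simp
  qed
  then have i: "i < L" using iL by simp
  \<comment> \<open>A block of more than one digit must begin with the digit \<open>L\<close>.\<close>
  have c0: "i \<le> c 0"
  proof (cases j)
    case (Suc j')
    then have "Suc 0 < k" using j by simp
    then have "C c (Suc 0) \<le> 0" by (rule Cj)
    then have "u (Suc (Suc (c 0))) \<le> 0" by (simp del: cheb.simps)
    then have "\<not> c 0 < L" using cheb_pos[of "Suc (c 0)"] by force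
    then show ?thesis using i by simp
  qed (simp add: i_def)
  have ratio: "mseq l n * D c k \<le> B c k" if "n \<le> c 0" for n
  proof -
    have "mseq l n \<le> mseq l (c 0)"
      using that orbit_digit_le[OF assms(1), of 0] by (intro mseq_mono)
    also have "\<dots> \<le> B c k / D c k" unfolding j using assms(1) Cj j by (intro ratio_ge_first_digit) auto
    finally show ?thesis using Dk by (simp add: pos_le_divide_eq)
  qed
  have B0: "0 \<le> B c k" using ratio[of 0] by simp
  have AD: "A c k * D c k = 1 + B c k * C c k" using row_det[of c k] by simp
  have DC: "D c k \<le> 1 + mseq l i * C c k"
  proof -
    have "u (Suc i) * D c k = D c j + u i * C c k"
      using D_C_relation[of c j] unfolding j i_def .
    also have "\<dots> \<le> 1 + u i * C c k" using Dj1 by simp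
    finally have "D c k \<le> (1 + u i * C c k) / u (Suc i)"
      using cheb_pos[OF iL] by (simp add: pos_le_divide_eq mult.commute)
    also have "\<dots> = 1 / u (Suc i) + mseq l i * C c k"
      using mseq_eq[OF iL] by (simp add: add_divide_distrib)
    also have "1 / u (Suc i) \<le> 1" using cheb_ge_1[OF i] by simp
    finally show ?thesis by simp
  qed
  have A1: "1 \<le> A c k"
  proof -
    have "D c k \<le> A c k * D c k"
    proof (cases "D c k \<le> 1")
      case True
      then show ?thesis using AD B0 Ck by (simp add: order_trans)
    next
      case False
      have "0 \<le> mseq l i" using iL mseq_mono[of i 0] by simp
      then have "mseq l i * 1 \<le> mseq l i * D c k" using False by (intro mult_left_mono) auto
      also have "\<dots> \<le> B c k" using ratio c0 by simp
      finally have "mseq l i * C c k \<le> B c k * C c k" using Ck by simp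
      then show ?thesis using DC AD by simp
    qed
    then show ?thesis using Dk by simp
  qed
  have "1 \<le> l * (A c k * B c k)" if "c 0 \<noteq> 0"
  proof -
    \<comment> \<open>Here \<open>mseq l 1 = 1 / l\<close> serves as a bound for all nonzero first digits.\<close>
    have "D c k \<le> l * B c k" using ratio[of 1] that l_pos by (simp add: h_def field_simps)
    then have "A c k * D c k \<le> A c k * (l * B c k)" using A1 by (intro mult_left_mono) auto
    moreover have "1 \<le> A c k * D c k" using AD B0 Ck by simp
    ultimately show ?thesis by (simp add: algebra_simps)
  qed
  then show ?thesis using that Ck Dk A1 B0 by blast
qed

section \<open>Shrinking cylinders\<close>

lemma row_add_block:
  fixes c n
  defines "c' \<equiv> \<lambda>j. c (n + j)"
  shows "C c (n + k) = C c n * A c' k + D c n * C c' k"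
    and "D c (n + k) = C c n * B c' k + D c n * D c' k"
  using row_linear[of c' "row c (0, 1) n" k] unfolding row_add c'_def by simp_all

text \<open>
  Appending a block with entries \<open>A', B', C', D'\<close> replaces \<open>C D\<close> by
  \<open>C D (1 + 2 B' C') + C\<^sup>2 A' B' + D\<^sup>2 C' D'\<close>, a sum of nonnegative terms.
\<close>

lemma product_grows:
  assumes "orbit c y" "\<And>s. \<exists>n\<ge>s. c n \<noteq> 0" "0 \<le> C c n" "0 < D c n"
  obtains m where "C c n \<le> C c m" "0 < C c m" "0 < D c m"
    "C c n * D c n \<le> C c m * D c m"
    "c n \<noteq> 0 \<Longrightarrow> C c n * D c n + (C c n)\<^sup>2 / l \<le> C c m * D c m"
proof -
  let ?c = "\<lambda>j. c (n + j)"
  have nz: "\<exists>m\<ge>s. ?c m \<noteq> 0" for s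
  proof -
    obtain m where "m \<ge> n + s" "c m \<noteq> 0" using assms(2) by blast
    then show ?thesis by (intro exI[of _ "m - n"]) auto
  qed
  obtain k where k: "0 < C ?c k" "0 < D ?c k" "1 \<le> A ?c k" "0 \<le> B ?c k"
    and kl: "c n \<noteq> 0 \<Longrightarrow> 1 \<le> l * (A ?c k * B ?c k)"
    using positive_block[OF orbit_shift[OF assms(1), of n] nz] by force
  define r s where "r = C c n" and "s = D c n"
  have rs: "0 \<le> r" "0 < s" using assms by (auto simp: r_def s_def)
  note eq = row_add_block[of c n k, folded r_def s_def]
  have AD: "A ?c k * D ?c k = 1 + B ?c k * C ?c k" using row_det[of ?c k] by simp
  have r_le: "r \<le> r * A ?c k" using k(3) rs(1) mult_left_mono[of 1 "A ?c k" r] by simp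
  have sC: "0 < s * C ?c k" using rs k by simp
  have prod: "C c (n + k) * D c (n + k) = r * s + 2 * (r * s * (B ?c k * C ?c k))
      + r\<^sup>2 * (A ?c k * B ?c k) + s\<^sup>2 * (C ?c k * D ?c k)"
    unfolding eq power2_eq_square using AD by algebra
  have nn: "0 \<le> r * s * (B ?c k * C ?c k)" "0 \<le> r\<^sup>2 * (A ?c k * B ?c k)"
      "0 \<le> s\<^sup>2 * (C ?c k * D ?c k)"
    using rs k by auto
  have quad: "r\<^sup>2 / l \<le> r\<^sup>2 * (A ?c k * B ?c k)" if "c n \<noteq> 0"
    using mult_left_mono[OF kl[OF that], of "r\<^sup>2"] l_pos by (simp add: field_simps)
  show ?thesis
  proof (rule that[of "n + k"])
    show "C c n \<le> C c (n + k)" using eq r_le sC r_def by linarith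
    show "0 < C c (n + k)" using eq r_le sC rs by linarith
    show "0 < D c (n + k)" using eq rs k by (simp add: add_nonneg_pos)
    show "C c n * D c n \<le> C c (n + k) * D c (n + k)"
      using prod nn unfolding r_def s_def by linarith
    show "C c n * D c n + (C c n)\<^sup>2 / l \<le> C c (n + k) * D c (n + k)" if "c n \<noteq> 0"
      using prod nn quad[OF that] unfolding r_def s_def by linarith
  qed
qed

text \<open>
  A digit 0 forms a block by itself and contributes nothing through \<open>A' B' = 0\<close>; passing over a run of
  zeros adds multiples of \<open>l D\<close> to \<open>C\<close> and leaves \<open>D\<close> unchanged.
\<close>

lemma skip_zeros:
  assumes "\<And>s. \<exists>n\<ge>s. c n \<noteq> 0" "0 \<le> C c n" "0 < D c n"
  obtains m where "c m \<noteq> 0" "C c n \<le> C c m" "D c m = D c n"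
proof -
  define k where "k = (LEAST k. c (n + k) \<noteq> 0)"
  have "\<exists>k. c (n + k) \<noteq> 0" using assms(1)[of n] by (metis le_add_diff_inverse)
  then have ck: "c (n + k) \<noteq> 0" unfolding k_def by (rule LeastI_ex)
  have "C c n \<le> C c (n + j) \<and> D c (n + j) = D c n" if "j \<le> k" for j
    using that
  proof (induction j)
    case (Suc j)
    then have "c (n + j) = 0" using not_less_Least[of j "\<lambda>k. c (n + k) \<noteq> 0"] unfolding k_def by simp
    moreover have "0 \<le> D c n * l" using assms(3) l_pos by simp
    ultimately show ?case using Suc by simp
  qed simp
  then show ?thesis using that ck by blast
qed

text \<open>
  After the first block \<open>C\<close> is at least some \<open>r > 0\<close>, and from then on each block that begins with a
  nonzero digit adds at least \<open>r\<^sup>2 / l\<close> to \<open>C D\<close>. Eventually \<open>1 / (C D)\<close> is smaller than any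
  supposed distance between the two starting points.
\<close>

lemma orbit_start_unique:
  assumes "orbit c y" "orbit c y'" shows "\<not> y 0 < y' 0"
proof
  assume less: "y 0 < y' 0"
  have nz: "\<exists>n\<ge>s. c n \<noteq> 0" for s
  proof -
    have "0 < y' s" using orbit_less[OF assms less, of s] orbit_nonneg[OF assms(1), of s] by simp
    then obtain n where "c (s + n) \<noteq> 0"
      using orbit_nonzero_digit[OF orbit_shift[OF assms(2), of s]] by auto
    then show ?thesis by (intro exI[of _ "s + n"]) auto
  qed
  note adv = product_grows[OF assms(1) nz]
  obtain n1 where n1: "0 < C c n1" "0 < D c n1" using adv[of 0] by auto
  define r where "r = C c n1"
  have r: "0 < r" using n1 r_def by simp
  have grow: "\<exists>n. r \<le> C c n \<and> 0 < D c n \<and> real N * (r\<^sup>2 / l) \<le> C c n * D c n" for N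
  proof (induction N)
    case 0
    show ?case using n1 by (intro exI[of _ n1]) (simp add: r_def)
  next
    case (Suc N)
    then obtain n where n: "r \<le> C c n" "0 < D c n" "real N * (r\<^sup>2 / l) \<le> C c n * D c n"
      by blast
    obtain m where m: "c m \<noteq> 0" "C c n \<le> C c m" "D c m = D c n"
      using skip_zeros[OF nz, of n] n r by auto
    obtain p where p: "C c m \<le> C c p" "0 < D c p"
      "C c m * D c m + (C c m)\<^sup>2 / l \<le> C c p * D c p"
      using adv[of m] m n r by auto
    have "r\<^sup>2 \<le> (C c m)\<^sup>2" using r n m by (intro power_mono) auto
    then have "r\<^sup>2 / l \<le> (C c m)\<^sup>2 / l" using l_pos by (simp add: divide_right_mono)
    moreover have "C c n * D c n \<le> C c m * D c m" using m n by simp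
    moreover have "real (Suc N) * (r\<^sup>2 / l) = real N * (r\<^sup>2 / l) + r\<^sup>2 / l"
      by (simp add: algebra_simps add_divide_distrib)
    ultimately have "real (Suc N) * (r\<^sup>2 / l) \<le> C c p * D c p"
      using p n by linarith
    then show ?case using p m n by (intro exI[of _ p]) auto
  qed
  have d: "0 < (y' 0 - y 0) * (r\<^sup>2 / l)" using less r l_pos by simp
  then obtain N where N: "1 < real N * ((y' 0 - y 0) * (r\<^sup>2 / l))"
    using reals_Archimedean3 by blast
  obtain n where n: "r \<le> C c n" "0 < D c n" "real N * (r\<^sup>2 / l) \<le> C c n * D c n"
    using grow by blast
  have "(y' 0 - y 0) * (real N * (r\<^sup>2 / l)) \<le> (y' 0 - y 0) * (C c n * D c n)"
    using n less by (intro mult_left_mono) auto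
  also have "\<dots> \<le> 1" using n r by (intro cylinder_length[OF assms]) auto
  finally show False using N by (simp add: mult.left_commute)
qed

lemma coding_real_inj:
  assumes "0 \<le> x" "x < x'" shows "coding_real l x \<noteq> coding_real l x'"
  using orbit_start_unique orbit_coding[of x] orbit_coding[of x'] assms
  by (metis funpow_0 less_imp_le order_trans)

section \<open>The coding of infinity\<close>

lemma coding_real_mono:
  assumes "0 \<le> x" "x \<le> x'" "\<And>k. k < n \<Longrightarrow> coding_real l x k = coding_real l x' k"
  shows "coding_real l x n \<le> coding_real l x' n"
proof -
  note o = orbit_coding[of x] orbit_coding[of x']
  have "0 \<le> (T l ^^ k) x \<and> (T l ^^ k) x \<le> (T l ^^ k) x'" if "k \<le> n" for k
    using that
  proof (induction k)
    case (Suc k)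
    then have IH: "0 \<le> (T l ^^ k) x" "(T l ^^ k) x \<le> (T l ^^ k) x'" by auto
    have eq: "digit l ((T l ^^ k) x) = digit l ((T l ^^ k) x')"
      using assms(3)[of k] Suc.prems by (simp add: coding_real_def)
    have st: "inverse_step (digit l ((T l ^^ k) x)) (T l ((T l ^^ k) x)) ((T l ^^ k) x)"
      "inverse_step (digit l ((T l ^^ k) x)) (T l ((T l ^^ k) x')) ((T l ^^ k) x')"
      using T_inverse_step IH eq by (metis order_trans)+
    show ?case
      using inverse_step_less[OF st] st(1) IH by (cases "(T l ^^ k) x = (T l ^^ k) x'")
        (auto simp: inverse_step_def)
  qed (use assms in simp)
  then show ?thesis unfolding coding_real_def by (intro digit_mono) auto
qed

text \<open>
  Once the first \<open>n\<close> digits are constant for large \<open>x\<close>, the next digit is a nondecreasing function of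
  \<open>x\<close> with values in \<open>{..L}\<close>, hence eventually constant as well. So the limiting word exists.
\<close>

lemma coding_infty_eventually: "\<forall>\<^sub>F x in at_top. \<forall>k\<le>n. coding_real l x k = coding_infty l k"
proof -
  define good where
    "good w n \<longleftrightarrow> (\<forall>\<^sub>F x in at_top. \<forall>k\<le>n. coding_real l x k = w k)" for w :: "nat \<Rightarrow> nat" and n
  have ev: "\<exists>v. \<forall>\<^sub>F x in at_top. coding_real l x n = v" for n
  proof (induction n rule: less_induct)
    case (less n)
    then obtain w where w: "\<And>k. k < n \<Longrightarrow> \<forall>\<^sub>F x in at_top. coding_real l x k = w k" by metis
    then have "\<forall>\<^sub>F x in at_top. \<forall>k\<in>{..<n}. coding_real l x k = w k"
      by (intro eventually_ball_finite) auto
    then obtain X0 where X0: "\<And>x k. X0 \<le> x \<Longrightarrow> k < n \<Longrightarrow> coding_real l x k = w k"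
      by (auto simp: eventually_at_top_linorder)
    define X where "X = max 0 X0"
    have mono: "coding_real l x n \<le> coding_real l x' n" if "X \<le> x" "x \<le> x'" for x x'
      using that X0 by (intro coding_real_mono) (auto simp: X_def)
    have "coding_real l x n \<le> L" if "X \<le> x" for x
      using orbit_digit_le[OF orbit_coding, of x n] that by (simp add: X_def)
    then have fin: "finite ((\<lambda>x. coding_real l x n) ` {X..})"
      by (intro finite_subset[OF _ finite_atMost[of L]]) auto
    have "Max ((\<lambda>x. coding_real l x n) ` {X..}) \<in> (\<lambda>x. coding_real l x n) ` {X..}"
      using fin by (intro Max_in) auto
    then obtain x0 where x0: "X \<le> x0" "coding_real l x0 n = Max ((\<lambda>x. coding_real l x n) ` {X..})"
      by auto
    have "coding_real l x n = coding_real l x0 n" if "x0 \<le> x" for x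
      using mono[OF x0(1) that] Max_ge[OF fin, of "coding_real l x n"] x0 that by auto
    then show ?case unfolding eventually_at_top_linorder by blast
  qed
  then obtain w where w: "\<And>n. \<forall>\<^sub>F x in at_top. coding_real l x n = w n" by metis
  have good_w: "good w n" for n
  proof -
    have "\<forall>\<^sub>F x in at_top. \<forall>k\<in>{..n}. coding_real l x k = w k"
      using w by (intro eventually_ball_finite) auto
    then show ?thesis unfolding good_def by (rule eventually_mono) simp
  qed
  have uniq: "v = w" if "\<forall>n. good v n" for v
  proof
    fix k
    have "\<forall>\<^sub>F x in at_top. coding_real l x k = v k"
      using that[rule_format, of k] unfolding good_def by (rule eventually_mono) simp
    then have "\<forall>\<^sub>F x::real in at_top. v k = w k"
      using w[of k] by eventually_elim simp
    then show "v k = w k" by simp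
  qed
  have "coding_infty l = w"
    unfolding coding_infty_def using good_w uniq unfolding good_def by (intro the_equality) blast+
  then show ?thesis using good_w unfolding good_def by simp
qed

text \<open>
  Every digit of \<open>x'\<close> is squeezed between the digit of \<open>x\<close> and the digit of some very large \<open>z\<close>.
\<close>

lemma coding_infty_above:
  assumes "0 \<le> x" "x \<le> x'" "coding_real l x = coding_infty l"
  shows "coding_real l x' = coding_infty l"
proof
  fix n
  show "coding_real l x' n = coding_infty l n"
  proof (induction n rule: less_induct)
    case (less n)
    have "\<forall>\<^sub>F z in at_top. x' \<le> z \<and> (\<forall>k\<le>n. coding_real l z k = coding_infty l k)"
      using coding_infty_eventually eventually_ge_at_top by (rule eventually_conj[rotated])
    then obtain z where z: "x' \<le> z" "\<And>k. k \<le> n \<Longrightarrow> coding_real l z k = coding_infty l k"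
      by (auto simp: eventually_at_top_linorder)
    have "coding_real l x n \<le> coding_real l x' n" "coding_real l x' n \<le> coding_real l z n"
      using assms less z coding_real_mono[of x x' n] coding_real_mono[of x' z n] by auto
    then show ?case using assms(3) z by simp
  qed
qed

lemma coding_infty_neq:
  assumes "0 \<le> x" shows "coding_real l x \<noteq> coding_infty l"
  using coding_real_inj[OF assms, of "x + 1"] coding_infty_above[OF assms, of "x + 1"] by auto

end

theorem theorem3p1:
  fixes l :: real and x x' :: ereal
  assumes "0 < l" and "l < 2"
    and "0 \<le> x" and "x < x'" and "x' \<le> \<infinity>"
  shows "coding l x \<noteq> coding l x'"
proof -
  interpret hecke_map l using assms by unfold_locales
  obtain r where r: "x = ereal r" "0 \<le> r" using assms by (cases x) auto
  show ?thesis
  proof (cases x')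
    case (real r')
    then show ?thesis using r assms coding_real_inj[of r r'] by (simp add: coding_def)
  next
    case PInf
    then show ?thesis using r coding_infty_neq by (simp add: coding_def)
  next
    case MInf
    then show ?thesis using assms by simp
  qed
qed

end
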